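(* Let $x$ and $y$ be two distinct points in the open unit disk $\mathbb{D}^2=\{z\in\mathbb{C}:|z|<1\}$. Then the arc (in $\mathbb{D}^2$) of the generalized circle orthogonal to the unit circle $\mathbb{S}^1$ that starts at $x$ and contains $y$ is a $\delta_{\mathbb{D}^2}$-geodesic starting at $x$ and passing through $y$.
   Context: The Apollonian weak metric of the unit disk is $\delta_{\mathbb{D}^2}(x,y)=\sup_{|a|=1}\log\frac{|x-a|}{|y-a|}$ for $x,y\in\mathbb{D}^2$. A weak metric on a set $X$ is a function $\delta:X\times X\to[0,\infty)$ with $\delta(x,x)=0$ and $\delta(x,y)+\delta(y,z)\ge\delta(x,z)$ for all $x,y,z\in X$ (no symmetry or separation is required); $\delta_{\mathbb{D}^2}$ is a weak metric on $\mathbb{D}^2$. For a weak metric $\delta$ on $X$, three points $x,y,z\in X$ (in that order) are called aligned if $\delta(x,z)=\delta(x,y)+\delta(y,z)$. A $\delta$-geodesic in $X$ is a path $\gamma:I\to X$, where $I\subset\mathbb{R}$ is an interval, such that for any $t_1\le t_2\le t_3$ in $I$ the points $\gamma(t_1),\gamma(t_2),\gamma(t_3)$ (in that order) are aligned. The orientation of the path matters. A generalized circle in $\overline{\mathbb{C}}=\mathbb{C}\cup\{\infty\}$ is a Euclidean circle or a Euclidean straight line compactified by $\infty$. Through two distinct points $x,y\in\mathbb{D}^2$ there is a unique generalized circle orthogonal to $\mathbb{S}^1$; the arc meant is the part of it inside $\mathbb{D}^2$ that starts at $x$, passes through $y$ and continues towards $\mathbb{S}^1$, traversed from $x$ in the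 direction of $y$. *)

theory Defs
  imports "HOL-Analysis.Analysis"
begin

text \<open>The supremum is over a set of reals that is bounded above when \<open>x\<close> and \<open>y\<close> lie in the
  open disk; elsewhere the value is not meaningful.\<close>

definition apollonian :: "complex \<Rightarrow> complex \<Rightarrow> real" where
  "apollonian x y = (SUP a\<in>sphere 0 1. ln (cmod (x - a) / cmod (y - a)))"

definition aligned :: "('a \<Rightarrow> 'a \<Rightarrow> real) \<Rightarrow> 'a \<Rightarrow> 'a \<Rightarrow> 'a \<Rightarrow> bool" where
  "aligned \<delta> x y z \<longleftrightarrow> \<delta> x z = \<delta> x y + \<delta> y z"

text \<open>Paths are continuous for the ambient topology, not for one derived from \<open>\<delta>\<close>.\<close>

definition weak_geodesic ::
  "('a::topological_space \<Rightarrow> 'a \<Rightarrow> real) \<Rightarrow> 'a set \<Rightarrow> real set \<Rightarrow> (real \<Rightarrow> 'a) \<Rightarrow> bool" where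
  "weak_geodesic \<delta> X I \<gamma> \<longleftrightarrow>
     is_interval I \<and> continuous_on I \<gamma> \<and> \<gamma> ` I \<subseteq> X \<and>
     (\<forall>t1\<in>I. \<forall>t2\<in>I. \<forall>t3\<in>I. t1 \<le> t2 \<longrightarrow> t2 \<le> t3 \<longrightarrow> aligned \<delta> (\<gamma> t1) (\<gamma> t2) (\<gamma> t3))"

text \<open>The extended plane is \<^typ>\<open>complex option\<close>, with \<^term>\<open>None\<close> as the point at infinity.\<close>

definition ext_circle :: "complex \<Rightarrow> real \<Rightarrow> complex option set" where
  "ext_circle c r = Some ` sphere c r"

definition ext_line :: "complex \<Rightarrow> complex \<Rightarrow> complex option set" where
  "ext_line a u = insert None (Some ` range (\<lambda>t::real. a + t *\<^sub>R u))"

definition generalized_circle :: "complex option set \<Rightarrow> bool" where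
  "generalized_circle C \<longleftrightarrow>
     (\<exists>c r. 0 < r \<and> C = ext_circle c r) \<or> (\<exists>a u. u \<noteq> 0 \<and> C = ext_line a u)"

definition tangent_vector :: "complex option set \<Rightarrow> complex \<Rightarrow> complex \<Rightarrow> bool" where
  "tangent_vector C p v \<longleftrightarrow> Some p \<in> C \<and>
     ((\<exists>c r. 0 < r \<and> C = ext_circle c r \<and> orthogonal v (p - c)) \<or>
      (\<exists>a u. u \<noteq> 0 \<and> C = ext_line a u \<and> v \<in> span {u}))"

text \<open>Two generalized circles meeting at a right angle have two common points, so at least one
  common finite point, and the angles at the two points agree. It therefore suffices to look at
  finite points.\<close>

definition orthogonal_circles :: "complex option set \<Rightarrow> complex option set \<Rightarrow> bool" where
  "orthogonal_circles C D \<longleftrightarrow>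
     (\<exists>p. Some p \<in> C \<inter> D) \<and>
     (\<forall>p v w. Some p \<in> C \<inter> D \<longrightarrow> tangent_vector C p v \<longrightarrow> tangent_vector D p w \<longrightarrow>
        orthogonal v w)"

definition orthogonal_circle_through :: "complex \<Rightarrow> complex \<Rightarrow> complex option set" where
  "orthogonal_circle_through x y =
     (THE C. generalized_circle C \<and> orthogonal_circles C (ext_circle 0 1) \<and>
             Some x \<in> C \<and> Some y \<in> C)"

text \<open>Removing \<open>x\<close> cuts the part of the circle inside the disk into two open arcs, each running
  from \<open>x\<close> to the unit circle; the one containing \<open>y\<close> is kept.\<close>

definition orthogonal_arc :: "complex \<Rightarrow> complex \<Rightarrow> complex set" where
  "orthogonal_arc x y =
     insert x (connected_component_set
       ({z \<in> ball 0 1. Some z \<in> orthogonal_circle_through x y} - {x}) y)"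

definition parametrizes_from :: "complex \<Rightarrow> complex set \<Rightarrow> real set \<Rightarrow> (real \<Rightarrow> complex) \<Rightarrow> bool" where
  "parametrizes_from x A I \<gamma> \<longleftrightarrow>
     is_interval I \<and> continuous_on I \<gamma> \<and> inj_on \<gamma> I \<and> \<gamma> ` I = A \<and>
     (\<exists>t0\<in>I. (\<forall>t\<in>I. t0 \<le> t) \<and> \<gamma> t0 = x)"

end

theory Submission
  imports Defs "HOL-Complex_Analysis.Riemann_Mapping"
begin

text \<open>The automorphism of the disk sending \<open>0\<close> to \<open>x\<close> carries the radius towards \<open>w\<close>, where
  \<open>|w| = 1\<close>, onto the arc. Up to a factor that does not depend on the boundary point, the quotient
  of distances \<open>|p - a| / |q - a|\<close> pulls back to the quotient for two points \<open>sw\<close>, \<open>tw\<close> of that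
  radius, and for \<open>s \<le> t\<close> the latter is largest at the endpoint \<open>w\<close>. So one boundary point attains
  all the suprema along the arc, and \<open>\<delta>\<close> is additive there.\<close>

section \<open>Circles orthogonal to the unit circle\<close>

text \<open>In the plane the vectors orthogonal to a nonzero vector form a line, so \<open>v\<close>
  is parallel to \<open>p\<close> and \<open>w\<close> to \<open>q\<close>.\<close>

lemma orthogonal_complex_trans:
  fixes v w p q :: complex
  assumes "orthogonal v q" "orthogonal w p" "orthogonal q p" "p \<noteq> 0" "q \<noteq> 0"
  shows "orthogonal v w"
proof -
  have p: "Re p ^ 2 + Im p ^ 2 \<noteq> 0" and q: "Re q ^ 2 + Im q ^ 2 \<noteq> 0"
    using assms(4,5) by (simp_all add: complex_eq_iff sum_power2_eq_zero_iff)
  \<comment> \<open>The nonzero factors make the claim a polynomial consequence of the three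
    hypotheses, without divisions.\<close>
  have "(Re p ^ 2 + Im p ^ 2) * (Re q ^ 2 + Im q ^ 2) * (Re v * Re w + Im v * Im w) = 0"
    using assms(1-3) unfolding orthogonal_def inner_complex_def by algebra
  then show ?thesis
    using p q by (metis mult_eq_0_iff orthogonal_def inner_complex_def inner_real_def)
qed

text \<open>Antipodal points of the first sphere are equally far from \<open>c'\<close>. Comparing
  them in the directions 1 and \<open>\<i>\<close> kills both coordinates of
  \<open>c' - c\<close>.\<close>

lemma sphere_complex_eq_imp_center_eq:
  fixes c c' :: complex
  assumes "0 < r" "sphere c r = sphere c' r'"
  shows "c = c'"
proof -
  have mem: "c + of_real r * u \<in> sphere c' r'" if "cmod u = 1" for u
    using assms that by (auto simp: dist_norm norm_mult simp flip: assms(2))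
  have "cmod (c' - (c + of_real r * u)) = r'" if "cmod u = 1" for u
    using mem[OF that] by (simp add: dist_norm)
  then have sq: "(cmod (c' - (c + of_real r * u)))\<^sup>2 = r'\<^sup>2" if "cmod u = 1" for u
    using that by simp
  have "r * (Re c' - Re c) = 0" "r * (Im c' - Im c) = 0"
    using sq[of 1, unfolded cmod_power2] sq[of "-1", unfolded cmod_power2]
      sq[of \<i>, unfolded cmod_power2] sq[of "-\<i>", unfolded cmod_power2]
    by (simp_all, algebra+)
  then show ?thesis
    using assms(1) by (simp add: complex_eq_iff)
qed

lemma ext_circle_center_unique:
  assumes "0 < r" "ext_circle c r = ext_circle c' r'"
  shows "c = c'"
  using assms sphere_complex_eq_imp_center_eq
  by (metis ext_circle_def inj_Some inj_image_eq_iff)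

lemma ext_circle_neq_ext_line: "ext_circle c r \<noteq> ext_line a u"
proof
  assume eq: "ext_circle c r = ext_line a u"
  have "None \<in> ext_circle c r"
    unfolding eq by (simp add: ext_line_def)
  then show False
    by (auto simp: ext_circle_def)
qed

text \<open>The definition of \<open>tangent_vector\<close> quantifies over all descriptions of the
  curve. Since the centre is determined by the circle, the given description suffices.\<close>

lemma tangent_vector_ext_circle:
  assumes "0 < r"
  shows "tangent_vector (ext_circle c r) p v \<longleftrightarrow> cmod (p - c) = r \<and> orthogonal v (p - c)"
proof -
  have "Some p \<in> ext_circle c r \<longleftrightarrow> cmod (p - c) = r"
    by (auto simp: ext_circle_def dist_norm norm_minus_commute)
  moreover have "(\<exists>c' r'. 0 < r' \<and> ext_circle c r = ext_circle c' r' \<and> orthogonal v (p - c'))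
      \<longleftrightarrow> orthogonal v (p - c)"
    using assms ext_circle_center_unique[OF assms] by blast
  ultimately show ?thesis
    by (simp add: tangent_vector_def ext_circle_neq_ext_line)
qed

text \<open>Differences of points of the line are multiples of \<open>u\<close>, so any other
  description of the line has a parallel direction.\<close>

lemma tangent_vector_ext_line_in_span:
  assumes "tangent_vector (ext_line a u) p v"
  shows "v \<in> span {u}"
proof -
  obtain a' u' where eq: "ext_line a u = ext_line a' u'" and v: "v \<in> span {u'}"
    using assms ext_circle_neq_ext_line by (metis tangent_vector_def)
  have "Some (a' + t *\<^sub>R u') \<in> ext_line a u" for t
    unfolding eq by (auto simp: ext_line_def)
  then have "\<exists>s. a' + t *\<^sub>R u' = a + s *\<^sub>R u" for t
    by (force simp: ext_line_def)
  from this[of 0] this[of 1] obtain s t where "a' = a + s *\<^sub>R u" "a' + u' = a + t *\<^sub>R u"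
    by (metis scale_zero_left scale_one add_0_right)
  then have "u' = (t - s) *\<^sub>R u"
    by (simp add: algebra_simps)
  then have "u' \<in> span {u}"
    by (simp add: span_base span_scale)
  then show ?thesis
    using v span_minimal[of "{u'}" "span {u}"] by auto
qed

text \<open>This is Pythagoras for the triangle 0, \<open>c\<close>, \<open>p\<close> at a common
  point \<open>p\<close>, where the two radii are perpendicular. For the converse a common point has
  to be exhibited as well.\<close>

lemma orthogonal_ext_circle_iff:
  assumes "0 < r"
  shows "orthogonal_circles (ext_circle c r) (ext_circle 0 1) \<longleftrightarrow> (cmod c)\<^sup>2 = 1 + r\<^sup>2"
proof
  assume orth: "orthogonal_circles (ext_circle c r) (ext_circle 0 1)"
  then obtain p where p: "Some p \<in> ext_circle c r \<inter> ext_circle 0 1"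
    unfolding orthogonal_circles_def by blast
  then have norms: "cmod (p - c) = r" "cmod p = 1"
    by (auto simp: ext_circle_def dist_norm norm_minus_commute)
  \<comment> \<open>Multiplication by \<open>\<i>\<close> turns each radius into a tangent
    vector.\<close>
  have "tangent_vector (ext_circle c r) p (\<i> * (p - c))" "tangent_vector (ext_circle 0 1) p (\<i> * p)"
    using assms norms
    by (simp_all add: tangent_vector_ext_circle orthogonal_def inner_complex_def algebra_simps)
  then have "orthogonal (\<i> * (p - c)) (\<i> * p)"
    using orth p unfolding orthogonal_circles_def by blast
  then have "(p - c) \<bullet> p = 0"
    by (simp add: orthogonal_def inner_complex_def algebra_simps)
  moreover have "(cmod (p - c))\<^sup>2 = r\<^sup>2" "(cmod p)\<^sup>2 = 1"
    using norms by simp_all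
  ultimately show "(cmod c)\<^sup>2 = 1 + r\<^sup>2"
    unfolding cmod_power2 inner_complex_def by (simp add: power2_eq_square algebra_simps)
next
  assume c: "(cmod c)\<^sup>2 = 1 + r\<^sup>2"
  have c0: "c \<noteq> 0"
    using c by (auto simp: add_nonneg_eq_0_iff)
  \<comment> \<open>This is \<open>c / (1 - \<i> * r)\<close>, the solution of
    \<open>p - c = \<i> * r * p\<close>: it lies on the unit circle and the radius from
    \<open>c\<close> is perpendicular to \<open>p\<close>.\<close>
  define p where "p = c * (1 + \<i> * r) / (cmod c)\<^sup>2"
  have "(cmod (1 + \<i> * r))\<^sup>2 = (cmod c)\<^sup>2"
    unfolding c by (simp add: cmod_power2)
  then have "cmod (1 + \<i> * r) = cmod c"
    by (simp add: power2_eq_iff_nonneg)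
  then have np: "cmod p = 1"
    using c0 unfolding p_def by (simp only: norm_mult norm_divide norm_of_real) (simp add: power2_eq_square)
  have pc: "p - c = \<i> * r * p"
  proof -
    have "p - \<i> * r * p = c * ((1 + \<i> * r) * (1 - \<i> * r)) / (cmod c)\<^sup>2"
      unfolding p_def by (simp add: algebra_simps diff_divide_distrib add_divide_distrib)
    also have "(1 + \<i> * r) * (1 - \<i> * r) = of_real ((cmod c)\<^sup>2)"
      unfolding c by (simp add: algebra_simps power2_eq_square)
    finally show ?thesis
      using c0 by (simp add: algebra_simps)
  qed
  have "cmod (p - c) = r"
    using np assms unfolding pc by (simp add: norm_mult)
  with np have "Some p \<in> ext_circle c r \<inter> ext_circle 0 1"
    by (simp add: ext_circle_def dist_norm norm_minus_commute)
  moreover have "orthogonal v w"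
    if "tangent_vector (ext_circle c r) p v" "tangent_vector (ext_circle 0 1) p w" for p v w
  proof (rule orthogonal_complex_trans)
    have norms: "cmod (p - c) = r" "cmod p = 1"
      and orth: "orthogonal v (p - c)" "orthogonal w p"
      using that assms by (simp_all add: tangent_vector_ext_circle)
    show "orthogonal v (p - c)" "orthogonal w p"
      by (rule orth)+
    show "p \<noteq> 0" "p - c \<noteq> 0"
      using norms assms by auto
    have "(cmod (p - c))\<^sup>2 = r\<^sup>2" "(cmod p)\<^sup>2 = 1"
      using norms by simp_all
    with c show "orthogonal (p - c) p"
      unfolding orthogonal_def cmod_power2 inner_complex_def
      by (simp add: power2_eq_square algebra_simps)
  qed
  ultimately show "orthogonal_circles (ext_circle c r) (ext_circle 0 1)"
    unfolding orthogonal_circles_def by blast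
qed

text \<open>Orthogonality eliminates \<open>r\<close> from the expanded equation of the circle. What
  remains is affine in \<open>c\<close>, so centres can be compared by subtraction.\<close>

lemma ext_circle_orthogonal_eq:
  assumes "0 < r" "(cmod c)\<^sup>2 = 1 + r\<^sup>2"
  shows "ext_circle c r = Some ` {z. 2 * (c \<bullet> z) = 1 + (cmod z)\<^sup>2}"
proof -
  have "cmod (c - z) = r \<longleftrightarrow> (cmod (c - z))\<^sup>2 = r\<^sup>2" for z
    using assms(1) by (simp add: power2_eq_iff_nonneg)
  also have "\<dots> z \<longleftrightarrow> 2 * (c \<bullet> z) = 1 + (cmod z)\<^sup>2" for z
    using assms(2) unfolding cmod_power2 inner_complex_def
    by (auto simp: power2_eq_square algebra_simps)
  finally show ?thesis
    by (simp add: ext_circle_def sphere_def dist_norm)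
qed

lemma ext_line_eq:
  assumes "u \<noteq> 0"
  shows "ext_line a u = insert None (Some ` {z. (\<i> * u) \<bullet> (z - a) = 0})"
proof -
  have "z \<in> range (\<lambda>t::real. a + t *\<^sub>R u)" if "(\<i> * u) \<bullet> (z - a) = 0" for z
  proof
    \<comment> \<open>Orthogonality to \<open>\<i> * u\<close> means that
      \<open>u * cnj (z - a)\<close> is real, which makes \<open>z - a\<close> a real multiple of
      \<open>u\<close>.\<close>
    have "Re (\<i> * u * cnj (z - a)) = 0"
      using that by (simp add: inner_complex_def algebra_simps)
    then have "u * cnj (z - a) = of_real (u \<bullet> (z - a))"
      by (simp add: complex_eq_iff inner_complex_def algebra_simps)
    then have "cnj u * (z - a) = of_real (u \<bullet> (z - a))"
      by (metis complex_cnj_cnj complex_cnj_complex_of_real complex_cnj_mult)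
    moreover have "u * cnj u = of_real (u \<bullet> u)"
      using complex_norm_square[of u] by (simp add: power2_norm_eq_inner)
    ultimately have "of_real (u \<bullet> u) * (z - a) = of_real (u \<bullet> (z - a)) * u"
      by (metis mult.assoc mult.commute)
    then have "a + ((u \<bullet> (z - a)) / (u \<bullet> u)) *\<^sub>R u = z"
      using assms by (simp add: scaleR_conv_of_real field_simps)
    then show "z = a + ((u \<bullet> (z - a)) / (u \<bullet> u)) *\<^sub>R u" ..
  qed auto
  moreover have "(\<i> * u) \<bullet> (a + t *\<^sub>R u - a) = 0" for t
    by (simp add: inner_complex_def)
  ultimately have "range (\<lambda>t::real. a + t *\<^sub>R u) = {z. (\<i> * u) \<bullet> (z - a) = 0}"
    by blast
  then show ?thesis
    by (simp add: ext_line_def)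
qed

text \<open>The right-hand side says that the line passes through 0. A line orthogonal to the unit
  circle runs along the radius at a common point; conversely, a line through 0 meets the circle at
  \<open>sgn u\<close>.\<close>

lemma orthogonal_ext_line_iff:
  assumes u: "u \<noteq> 0"
  shows "orthogonal_circles (ext_line a u) (ext_circle 0 1) \<longleftrightarrow> (\<i> * u) \<bullet> a = 0"
proof
  assume orth: "orthogonal_circles (ext_line a u) (ext_circle 0 1)"
  then obtain p where p: "Some p \<in> ext_line a u \<inter> ext_circle 0 1"
    unfolding orthogonal_circles_def by blast
  then have "cmod p = 1" and pa: "(\<i> * u) \<bullet> (p - a) = 0"
    by (auto simp: ext_circle_def ext_line_eq[OF u])
  then have "tangent_vector (ext_circle 0 1) p (\<i> * p)"
    by (simp add: tangent_vector_ext_circle orthogonal_def inner_complex_def algebra_simps)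
  moreover have "tangent_vector (ext_line a u) p u"
    unfolding tangent_vector_def using p u span_base[of u "{u}"] by blast
  ultimately have "orthogonal u (\<i> * p)"
    using orth p unfolding orthogonal_circles_def by blast
  with pa show "(\<i> * u) \<bullet> a = 0"
    by (simp add: orthogonal_def inner_complex_def algebra_simps)
next
  assume a: "(\<i> * u) \<bullet> a = 0"
  have line: "Some z \<in> ext_line a u \<longleftrightarrow> (\<i> * u) \<bullet> z = 0" for z
    using a by (auto simp: ext_line_eq[OF u] inner_diff_right)
  have "(\<i> * u) \<bullet> sgn u = 0"
    by (simp add: sgn_div_norm inner_complex_def)
  then have "Some (sgn u) \<in> ext_line a u \<inter> ext_circle 0 1"
    using line u by (simp add: ext_circle_def norm_sgn)
  moreover have "orthogonal v w"
    if p_line: "Some p \<in> ext_line a u" and v: "tangent_vector (ext_line a u) p v"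
      and w: "tangent_vector (ext_circle 0 1) p w" for p v w
  proof (rule orthogonal_complex_trans)
    have p: "cmod p = 1" "orthogonal w p"
      using w by (simp_all add: tangent_vector_ext_circle)
    then show "orthogonal w p" "p \<noteq> 0"
      by auto
    show "\<i> * u \<noteq> 0"
      using u by simp
    show "orthogonal (\<i> * u) p"
      using p_line line by (simp add: orthogonal_def)
    obtain k where "v = k *\<^sub>R u"
      using tangent_vector_ext_line_in_span[OF v] by (auto simp: span_singleton)
    then show "orthogonal v (\<i> * u)"
      by (simp add: orthogonal_def inner_complex_def)
  qed
  ultimately show "orthogonal_circles (ext_line a u) (ext_circle 0 1)"
    unfolding orthogonal_circles_def by blast
qed

lemma orthogonal_generalized_circle_iff:
  "generalized_circle C \<and> orthogonal_circles C (ext_circle 0 1) \<longleftrightarrow>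
     (\<exists>c. 1 < cmod c \<and> C = Some ` {z. 2 * (c \<bullet> z) = 1 + (cmod z)\<^sup>2}) \<or>
     (\<exists>n. n \<noteq> 0 \<and> C = insert None (Some ` {z. n \<bullet> z = 0}))" (is "?L \<longleftrightarrow> ?R")
proof
  assume ?L
  then consider c r where "0 < r" "C = ext_circle c r" "orthogonal_circles C (ext_circle 0 1)"
    | a u where "u \<noteq> 0" "C = ext_line a u" "orthogonal_circles C (ext_circle 0 1)"
    unfolding generalized_circle_def by blast
  then show ?R
  proof cases
    case 1
    then have c: "(cmod c)\<^sup>2 = 1 + r\<^sup>2"
      by (simp add: orthogonal_ext_circle_iff)
    then have "1\<^sup>2 < (cmod c)\<^sup>2"
      using 1(1) by simp
    then have "1 < cmod c"
      by (rule power_less_imp_less_base) simp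
    then show ?thesis
      using 1 ext_circle_orthogonal_eq[OF 1(1) c] by blast
  next
    case 2
    then have "(\<i> * u) \<bullet> a = 0"
      by (simp add: orthogonal_ext_line_iff)
    then have "C = insert None (Some ` {z. (\<i> * u) \<bullet> z = 0})"
      using 2 by (simp add: ext_line_eq inner_diff_right)
    moreover have "\<i> * u \<noteq> 0"
      using 2 by simp
    ultimately show ?thesis
      by blast
  qed
next
  assume ?R
  then show ?L
  proof (elim disjE exE conjE)
    fix c
    assume c: "1 < cmod c" and C: "C = Some ` {z. 2 * (c \<bullet> z) = 1 + (cmod z)\<^sup>2}"
    define r where "r = sqrt ((cmod c)\<^sup>2 - 1)"
    have "1 < (cmod c)\<^sup>2"
      using c by (simp add: one_less_power)
    then have r: "0 < r" "(cmod c)\<^sup>2 = 1 + r\<^sup>2"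
      by (simp_all add: r_def)
    then have "C = ext_circle c r"
      using C ext_circle_orthogonal_eq by simp
    then show ?L
      using r orthogonal_ext_circle_iff unfolding generalized_circle_def by blast
  next
    fix n :: complex
    assume n: "n \<noteq> 0" and C: "C = insert None (Some ` {z. n \<bullet> z = 0})"
    \<comment> \<open>The direction is \<open>n\<close> turned by a right angle, so that the normal
      in \<open>ext_line_eq\<close> is \<open>n\<close> again.\<close>
    have "C = ext_line 0 (- \<i> * n)"
      using n C by (simp add: ext_line_eq)
    moreover have "- \<i> * n \<noteq> 0"
      using n by simp
    moreover have "orthogonal_circles (ext_line 0 (- \<i> * n)) (ext_circle 0 1)"
      using orthogonal_ext_line_iff[OF calculation(2), of 0] by simp
    ultimately show ?L
      unfolding generalized_circle_def by blast
  qed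
qed

text \<open>On a line through 0 the equation of the circle is a quadratic whose two roots are
  inverse to each other in the unit circle, so they cannot both lie in the open disk.\<close>

lemma orthogonal_circle_disjoint_diameter:
  assumes "cmod x < 1" "cmod y < 1" "x \<noteq> y" "n \<noteq> 0" "n \<bullet> x = 0" "n \<bullet> y = 0"
    and c: "2 * (c \<bullet> x) = 1 + (cmod x)\<^sup>2" "2 * (c \<bullet> y) = 1 + (cmod y)\<^sup>2"
  shows False
proof -
  have "Some z \<in> ext_line 0 (\<i> * n)" if "n \<bullet> z = 0" for z
    using assms(4) that by (simp add: ext_line_eq inner_complex_def)
  then have "\<exists>t. z = t *\<^sub>R (\<i> * n)" if "n \<bullet> z = 0" for z
    using that by (fastforce simp: ext_line_def)
  then obtain s t where x: "x = s *\<^sub>R (\<i> * n)" and y: "y = t *\<^sub>R (\<i> * n)"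
    using assms(5,6) by blast
  define m where "m = cmod n"
  have cx: "2 * s * (c \<bullet> (\<i> * n)) = 1 + s\<^sup>2 * m\<^sup>2"
    using c(1) unfolding x by (simp add: norm_mult power_mult_distrib m_def)
  have cy: "2 * t * (c \<bullet> (\<i> * n)) = 1 + t\<^sup>2 * m\<^sup>2"
    using c(2) unfolding y by (simp add: norm_mult power_mult_distrib m_def)
  have "(t - s) * (1 - s * t * m\<^sup>2) = 0"
    using cx cy by algebra
  moreover have "t \<noteq> s"
    using assms(3) x y by auto
  moreover have "\<bar>s\<bar> * m < 1" "\<bar>t\<bar> * m < 1"
    using assms(1,2) unfolding x y by (simp_all add: norm_mult m_def)
  then have "(\<bar>s\<bar> * m) * (\<bar>t\<bar> * m) < 1 * 1"
    by (intro mult_strict_mono') (auto simp: m_def)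
  then have "s * t * m\<^sup>2 < 1"
    using abs_ge_self[of "s * t * m\<^sup>2"]
    by (simp add: abs_mult power2_eq_square m_def algebra_simps)
  ultimately show False
    by simp
qed

text \<open>Two lines through 0 agree because one of \<open>x\<close>, \<open>y\<close> is nonzero;
  the mixed case is excluded by the preceding lemma. If two circles had different centres, the
  difference of the centres would be normal to a diameter through \<open>x\<close> and
  \<open>y\<close>, which reduces to the mixed case.\<close>

lemma orthogonal_circle_unique:
  assumes "cmod x < 1" "cmod y < 1" "x \<noteq> y"
    and C: "generalized_circle C" "orthogonal_circles C (ext_circle 0 1)" "Some x \<in> C" "Some y \<in> C"
    and D: "generalized_circle D" "orthogonal_circles D (ext_circle 0 1)" "Some x \<in> D" "Some y \<in> D"
  shows "C = D"
proof -
  note no = orthogonal_circle_disjoint_diameter[OF assms(1-3)]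
  have lines: "{z. m \<bullet> z = 0} \<subseteq> {z. n \<bullet> z = 0}"
    if "m \<noteq> 0" "n \<noteq> 0" "m \<bullet> x = 0" "m \<bullet> y = 0" "n \<bullet> x = 0" "n \<bullet> y = 0" for m n :: complex
  proof clarify
    fix z assume z: "m \<bullet> z = 0"
    define p where "p = (if x = 0 then y else x)"
    have p: "p \<noteq> 0" "m \<bullet> p = 0" "n \<bullet> p = 0"
      using that assms(3) by (auto simp: p_def)
    have "orthogonal z m" "orthogonal n p" "orthogonal m p"
      using z p by (simp_all add: orthogonal_def inner_commute)
    then have "orthogonal z n"
      using orthogonal_complex_trans p(1) that(1) by blast
    then show "n \<bullet> z = 0"
      by (simp add: orthogonal_def inner_commute)
  qed
  have mem: "Some z \<in> Some ` A \<longleftrightarrow> z \<in> A" "Some z \<in> insert None (Some ` A) \<longleftrightarrow> z \<in> A"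
    for z :: complex and A
    by auto
  have "\<exists>c. 2 * (c \<bullet> x) = 1 + (cmod x)\<^sup>2 \<and> 2 * (c \<bullet> y) = 1 + (cmod y)\<^sup>2 \<and>
            E = Some ` {z. 2 * (c \<bullet> z) = 1 + (cmod z)\<^sup>2} \<or>
          (\<exists>n. n \<noteq> 0 \<and> n \<bullet> x = 0 \<and> n \<bullet> y = 0 \<and> E = insert None (Some ` {z. n \<bullet> z = 0}))"
    if "generalized_circle E" "orthogonal_circles E (ext_circle 0 1)" "Some x \<in> E" "Some y \<in> E"
    for E
    using orthogonal_generalized_circle_iff[of E] that by (auto simp: mem)
  note cases = this[OF C] this[OF D]
  have circles: "c = d"
    if "2 * (c \<bullet> x) = 1 + (cmod x)\<^sup>2" "2 * (c \<bullet> y) = 1 + (cmod y)\<^sup>2"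
      "2 * (d \<bullet> x) = 1 + (cmod x)\<^sup>2" "2 * (d \<bullet> y) = 1 + (cmod y)\<^sup>2" for c d
    using no[of "c - d" c] that by (auto simp: inner_diff_left)
  show ?thesis
    using cases no lines circles by (smt (verit) subset_antisym)
qed


text \<open>For \<open>z\<close> in the disk the equation says that the automorphism taking
  \<open>x\<close> to 0 sends \<open>z\<close> to the line spanned by \<open>w\<close>; the positive
  factor \<open>(cmod (1 - cnj x * z))\<^sup>2\<close> has been cleared.\<close>

lemma orthogonal_circle_exists:
  assumes "cmod x < 1" "w \<noteq> 0"
  obtains C where "generalized_circle C" "orthogonal_circles C (ext_circle 0 1)"
    "\<And>z. Some z \<in> C \<longleftrightarrow> Im (cnj w * ((z - x) * (1 - x * cnj z))) = 0"
proof -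
  \<comment> \<open>Expanding the equation gives a part linear in \<open>z\<close>, with normal
    \<open>n\<close>, and a multiple \<open>k\<close> of \<open>1 + (cmod z)\<^sup>2\<close>. It is
    a line through 0 if \<open>k = 0\<close>, and otherwise a circle centred at
    \<open>n /\<^sub>R (2 * k)\<close>.\<close>
  define B where "B = cnj w - w * (cnj x)\<^sup>2"
  define n where "n = Complex (Im B) (Re B)"
  define k where "k = Im (cnj w * x)"
  have eq: "Im (cnj w * ((z - x) * (1 - x * cnj z))) = n \<bullet> z - k * (1 + (cmod z)\<^sup>2)" for z
    unfolding cmod_power2 n_def B_def k_def inner_complex_def
    by (simp add: power2_eq_square algebra_simps)
  \<comment> \<open>This identity puts that centre outside the closed unit disk, and also gives
    \<open>n \<noteq> 0\<close>.\<close>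
  have "(cmod n)\<^sup>2 = (2 * k)\<^sup>2 + (cmod w)\<^sup>2 * (1 - (cmod x)\<^sup>2)\<^sup>2"
    unfolding cmod_power2 n_def B_def k_def
    by (simp add: power2_eq_square algebra_simps)
  moreover have "(cmod x)\<^sup>2 < 1"
    using assms(1) by (simp add: power_less_one_iff)
  ultimately have "(2 * \<bar>k\<bar>)\<^sup>2 < (cmod n)\<^sup>2"
    using assms(2) by (simp add: power_mult_distrib)
  then have nk: "2 * \<bar>k\<bar> < cmod n"
    by (rule power_less_imp_less_base) simp
  then have "n \<noteq> 0"
    by auto
  define C where "C = (if k = 0 then insert None (Some ` {z. n \<bullet> z = 0})
    else Some ` {z. 2 * ((n /\<^sub>R (2 * k)) \<bullet> z) = 1 + (cmod z)\<^sup>2})"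
  have "1 < cmod (n /\<^sub>R (2 * k))" if "k \<noteq> 0"
    using nk that by (simp add: field_simps)
  then have "generalized_circle C \<and> orthogonal_circles C (ext_circle 0 1)"
    unfolding orthogonal_generalized_circle_iff using \<open>n \<noteq> 0\<close> by (cases "k = 0") (metis C_def)+
  moreover have "Some z \<in> C \<longleftrightarrow> Im (cnj w * ((z - x) * (1 - x * cnj z))) = 0" for z
    unfolding eq by (auto simp: C_def field_simps)
  ultimately show ?thesis
    using that by blast
qed

section \<open>The arc as the image of a radius\<close>

lemma one_minus_cnj_mult_neq_0:
  assumes "cmod x < 1" "cmod z \<le> 1"
  shows "1 - cnj x * z \<noteq> 0"
proof -
  have "cmod (cnj x * z) \<le> cmod x * 1"
    unfolding norm_mult complex_mod_cnj using assms(2) by (intro mult_left_mono) auto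
  then have "cmod (cnj x * z) \<noteq> 1"
    using assms(1) by simp
  then show ?thesis
    by force
qed

text \<open>The denominator splits into a factor for \<open>a\<close> and one for \<open>b\<close>;
  in a quotient of two differences with the same \<open>b\<close>, the latter cancels.\<close>

lemma Moebius_function_diff:
  assumes "cmod x < 1" "cmod a \<le> 1" "cmod b \<le> 1"
  shows "Moebius_function 0 x a - Moebius_function 0 x b =
    (1 - cnj x * x) * (a - b) / ((1 - cnj x * a) * (1 - cnj x * b))"
  using one_minus_cnj_mult_neq_0[OF assms(1,2)] one_minus_cnj_mult_neq_0[OF assms(1,3)]
  by (simp add: Moebius_function_simple divide_simps) (simp add: algebra_simps)

lemma Moebius_function_norm_eq_1:
  assumes "cmod x < 1" "cmod z = 1"
  shows "cmod (Moebius_function 0 x z) = 1"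
proof -
  have "z * cnj z = 1"
    using assms(2) complex_norm_square[of z] by simp
  then have "cnj (1 - cnj x * z) * z = z - x"
    by (simp add: algebra_simps)
  then have "cmod (z - x) = cmod (1 - cnj x * z)"
    using assms(2) by (metis complex_mod_cnj mult.right_neutral norm_mult)
  then show ?thesis
    using one_minus_cnj_mult_neq_0[of x z] assms by (simp add: Moebius_function_simple norm_divide)
qed

lemma Moebius_function_inverse:
  assumes "cmod x < 1" "cmod z \<le> 1"
  shows "Moebius_function 0 (- x) (Moebius_function 0 x z) = z"
proof -
  have "1 - cnj x * z \<noteq> 0" "1 - cnj x * x \<noteq> 0"
    using one_minus_cnj_mult_neq_0 assms by simp_all
  moreover have "1 - cnj x * z + cnj x * (z - x) \<noteq> 0"
    using calculation(2) by (simp add: algebra_simps)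
  ultimately show ?thesis
    by (simp add: Moebius_function_simple divide_simps) (simp add: algebra_simps)
qed

text \<open>The automorphism used here sends 0 to \<open>x\<close>. The parameter is the Euclidean
  coordinate on the diameter, not hyperbolic length; for \<open>cmod w = 1\<close> the value at 1 is
  the endpoint on the unit circle.\<close>

definition hyperbolic_ray :: "complex \<Rightarrow> complex \<Rightarrow> real \<Rightarrow> complex" where
  "hyperbolic_ray x w t = Moebius_function 0 (- x) (of_real t * w)"

text \<open>Taking the real part extends the parameter of the ray to a function on the whole disk, a
  continuous left inverse of the ray.\<close>

definition ray_coordinate :: "complex \<Rightarrow> complex \<Rightarrow> complex \<Rightarrow> real" where
  "ray_coordinate x w z = Re (cnj w * Moebius_function 0 x z)"

lemma ray_coordinate_hyperbolic_ray:
  assumes "cmod x < 1" "cmod w = 1" "\<bar>t\<bar> \<le> 1"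
  shows "ray_coordinate x w (hyperbolic_ray x w t) = t"
proof -
  have "Moebius_function 0 x (hyperbolic_ray x w t) = of_real t * w"
    using Moebius_function_inverse[of "- x" "of_real t * w"] assms
    by (simp add: hyperbolic_ray_def norm_mult)
  moreover have "cnj w * w = 1"
    using assms(2) complex_norm_square[of w] by (simp add: mult.commute)
  ultimately show ?thesis
    by (metis Re_complex_of_real mult.left_commute mult.right_neutral ray_coordinate_def)
qed

lemma hyperbolic_ray_in_ball:
  assumes "cmod x < 1" "cmod w = 1" "\<bar>t\<bar> < 1"
  shows "hyperbolic_ray x w t \<in> ball 0 1"
  using Moebius_function_norm_lt_1[of "- x" "of_real t * w"] assms
  by (simp add: hyperbolic_ray_def norm_mult)

lemma hyperbolic_ray_0 [simp]: "hyperbolic_ray x w 0 = x"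
  by (simp add: hyperbolic_ray_def Moebius_function_simple)

lemma continuous_on_hyperbolic_ray:
  assumes "cmod x < 1" "cmod w = 1"
  shows "continuous_on {-1<..<1} (hyperbolic_ray x w)"
proof -
  have "(\<lambda>t. of_real t * w) ` {-1<..<1} \<subseteq> ball 0 1"
    using assms(2) by (auto simp: norm_mult abs_less_iff)
  moreover have "continuous_on (ball 0 1) (Moebius_function 0 (- x))"
    using assms(1) by (simp add: holomorphic_on_imp_continuous_on Moebius_function_holomorphic)
  ultimately have "continuous_on {-1<..<1} (Moebius_function 0 (- x) \<circ> (\<lambda>t. of_real t * w))"
    by (intro continuous_on_compose continuous_intros) (rule continuous_on_subset)
  then show ?thesis
    by (simp add: hyperbolic_ray_def[abs_def] o_def)
qed

lemma continuous_on_ray_coordinate: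
  assumes "cmod x < 1"
  shows "continuous_on (ball 0 1) (ray_coordinate x w)"
  unfolding ray_coordinate_def
  by (intro continuous_intros holomorphic_on_imp_continuous_on Moebius_function_holomorphic assms)

text \<open>Up to a positive factor, the expression under \<open>Im\<close> is \<open>cnj w\<close>
  times the image of \<open>z\<close> under the automorphism taking \<open>x\<close> to 0. It is
  real exactly when that image lies on the diameter through \<open>w\<close>.\<close>

lemma hyperbolic_ray_on_circle_iff:
  assumes "cmod x < 1" "cmod w = 1" "cmod z < 1"
  shows "Im (cnj w * ((z - x) * (1 - x * cnj z))) = 0 \<longleftrightarrow>
    (\<exists>t. \<bar>t\<bar> < 1 \<and> z = hyperbolic_ray x w t)" (is "?L \<longleftrightarrow> ?R")
proof -
  define \<zeta> where "\<zeta> = Moebius_function 0 x z"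
  have \<zeta>: "cmod \<zeta> < 1" "Moebius_function 0 (- x) \<zeta> = z"
    using assms Moebius_function_norm_lt_1 Moebius_function_inverse by (simp_all add: \<zeta>_def)
  have ww: "w * cnj w = 1"
    using assms(2) complex_norm_square[of w] by simp
  have nz: "1 - cnj x * z \<noteq> 0"
    using one_minus_cnj_mult_neq_0 assms by simp
  have "(z - x) * (1 - x * cnj z) = \<zeta> * ((1 - cnj x * z) * cnj (1 - cnj x * z))"
    using nz by (simp add: \<zeta>_def Moebius_function_simple)
  also have "\<dots> = \<zeta> * of_real ((cmod (1 - cnj x * z))\<^sup>2)"
    by (simp only: complex_norm_square)
  finally have "cnj w * ((z - x) * (1 - x * cnj z)) = of_real ((cmod (1 - cnj x * z))\<^sup>2) * (cnj w * \<zeta>)"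
    by (simp add: algebra_simps)
  then have L: "?L \<longleftrightarrow> Im (cnj w * \<zeta>) = 0"
    using nz by (simp only: times_complex.sel Re_complex_of_real Im_complex_of_real) simp
  show ?thesis
  proof
    assume ?L
    then have real: "cnj w * \<zeta> = of_real (Re (cnj w * \<zeta>))"
      unfolding L by (simp add: complex_eq_iff)
    have "\<zeta> = w * (cnj w * \<zeta>)"
      using ww by (simp flip: mult.assoc)
    then have "z = hyperbolic_ray x w (Re (cnj w * \<zeta>))"
      unfolding hyperbolic_ray_def using \<zeta>(2) real by (metis mult.commute)
    moreover have "\<bar>Re (cnj w * \<zeta>)\<bar> < 1"
      using abs_Re_le_cmod[of "cnj w * \<zeta>"] \<zeta>(1) assms(2) by (simp add: norm_mult)
    ultimately show ?R
      by blast
  next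
    assume ?R
    then obtain t where "\<bar>t\<bar> < 1" "z = hyperbolic_ray x w t"
      by blast
    then have "\<zeta> = of_real t * w"
      using Moebius_function_inverse[of "- x" "of_real t * w"] assms
      by (simp add: \<zeta>_def hyperbolic_ray_def norm_mult)
    then have "cnj w * \<zeta> = of_real t"
      using ww by (simp add: mult.left_commute mult.commute)
    then show ?L
      unfolding L by simp
  qed
qed

lemma orthogonal_arc_eq_hyperbolic_ray:
  assumes x: "cmod x < 1" and y: "cmod y < 1" and "x \<noteq> y"
  obtains w where "cmod w = 1" "orthogonal_arc x y = hyperbolic_ray x w ` {0..<1}"
    "y \<in> hyperbolic_ray x w ` {0..<1}"
proof -
  define \<zeta> where "\<zeta> = Moebius_function 0 x y"
  \<comment> \<open>With this direction \<open>y\<close> has the positive parameter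
    \<open>cmod \<zeta>\<close>, so it lies on the half of the geodesic with
    \<open>t > 0\<close>.\<close>
  define w where "w = sgn \<zeta>"
  have \<zeta>: "cmod \<zeta> < 1" "Moebius_function 0 (- x) \<zeta> = y"
    using x y Moebius_function_norm_lt_1 Moebius_function_inverse by (simp_all add: \<zeta>_def)
  have "\<zeta> \<noteq> 0"
    using assms one_minus_cnj_mult_neq_0[of x y] by (simp add: \<zeta>_def Moebius_function_simple)
  then have w: "cmod w = 1"
    by (simp add: w_def norm_sgn)
  have "of_real (cmod \<zeta>) * w = \<zeta>"
    using \<open>\<zeta> \<noteq> 0\<close> by (simp add: w_def sgn_eq)
  then have y_ray: "y = hyperbolic_ray x w (cmod \<zeta>)"
    using \<zeta>(2) by (simp add: hyperbolic_ray_def)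
  have "w \<noteq> 0"
    using w by auto
  obtain C where C: "generalized_circle C" "orthogonal_circles C (ext_circle 0 1)"
    and C_iff: "\<And>z. Some z \<in> C \<longleftrightarrow> Im (cnj w * ((z - x) * (1 - x * cnj z))) = 0"
    using orthogonal_circle_exists[OF x \<open>w \<noteq> 0\<close>] by blast
  have C_ray: "Some z \<in> C \<longleftrightarrow> (\<exists>t. \<bar>t\<bar> < 1 \<and> z = hyperbolic_ray x w t)" if "cmod z < 1" for z
    using C_iff hyperbolic_ray_on_circle_iff[OF x w that] by simp
  have xC: "Some x \<in> C"
    by (simp add: C_iff)
  have yC: "Some y \<in> C"
    using C_ray[OF y] y_ray \<zeta>(1) by (metis abs_norm_cancel)
  have through: "orthogonal_circle_through x y = C"
    unfolding orthogonal_circle_through_def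
    using C xC yC orthogonal_circle_unique[OF assms] by (intro the_equality) blast+
  define S where "S = {z \<in> ball 0 1. Some z \<in> orthogonal_circle_through x y} - {x}"
  have S: "S = hyperbolic_ray x w ` ({-1<..<1} - {0})"
  proof (rule set_eqI)
    fix z
    have "z \<in> S \<longleftrightarrow> z \<in> ball 0 1 \<and> z \<noteq> x \<and> (\<exists>t. \<bar>t\<bar> < 1 \<and> z = hyperbolic_ray x w t)"
      using C_ray by (auto simp: S_def through)
    also have "\<dots> \<longleftrightarrow> z \<noteq> x \<and> (\<exists>t. \<bar>t\<bar> < 1 \<and> z = hyperbolic_ray x w t)"
      using hyperbolic_ray_in_ball[OF x w] by blast
    also have "\<dots> \<longleftrightarrow> (\<exists>t. \<bar>t\<bar> < 1 \<and> t \<noteq> 0 \<and> z = hyperbolic_ray x w t)"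
      using ray_coordinate_hyperbolic_ray[OF x w] hyperbolic_ray_0
      by (metis abs_zero zero_le_one less_imp_le)
    finally show "z \<in> S \<longleftrightarrow> z \<in> hyperbolic_ray x w ` ({-1<..<1} - {0})"
      by (auto simp: abs_less_iff image_iff)
  qed
  have coord: "ray_coordinate x w (hyperbolic_ray x w t) = t" if "t \<in> {-1<..<1}" for t
    using ray_coordinate_hyperbolic_ray[OF x w] that by auto
  have y_coord: "ray_coordinate x w y = cmod \<zeta>"
    using ray_coordinate_hyperbolic_ray[OF x w, of "cmod \<zeta>"] \<zeta>(1) by (simp flip: y_ray)
  have yS: "y \<in> S"
    using y yC \<open>x \<noteq> y\<close> by (simp add: S_def through)
  let ?K = "connected_component_set S y"
  have "?K = hyperbolic_ray x w ` {0<..<1}"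
  proof
    have "connected (hyperbolic_ray x w ` {0<..<1})"
      by (intro connected_continuous_image continuous_on_subset[OF continuous_on_hyperbolic_ray[OF x w]])
        auto
    moreover have "y \<in> hyperbolic_ray x w ` {0<..<1}"
      using y_ray \<zeta>(1) \<open>\<zeta> \<noteq> 0\<close> by auto
    ultimately show "hyperbolic_ray x w ` {0<..<1} \<subseteq> ?K"
      by (intro connected_component_maximal) (auto simp: S)
  next
    \<comment> \<open>The coordinates of the component form an interval that avoids 0 and contains
      \<open>cmod \<zeta>\<close>; hence they are all positive.\<close>
    have K: "?K \<subseteq> S"
      by (rule connected_component_subset)
    have "connected (ray_coordinate x w ` ?K)"
      using K by (intro connected_continuous_image continuous_on_subset[OF continuous_on_ray_coordinate[OF x]])
        (auto simp: S_def)
    then have "is_interval (ray_coordinate x w ` ?K)"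
      by (simp add: is_interval_connected_1)
    moreover have "0 \<notin> ray_coordinate x w ` ?K"
      using K coord unfolding S by force
    moreover have "cmod \<zeta> \<in> ray_coordinate x w ` ?K"
      using yS y_coord by (metis connected_component_refl image_eqI mem_Collect_eq)
    ultimately have pos: "0 < ray_coordinate x w z" if "z \<in> ?K" for z
      using that unfolding is_interval_1 by (metis imageI linorder_not_le norm_ge_zero)
    show "?K \<subseteq> hyperbolic_ray x w ` {0<..<1}"
    proof
      fix z assume z: "z \<in> ?K"
      then obtain t where t: "t \<in> {-1<..<1}" "z = hyperbolic_ray x w t"
        using K S by blast
      then have "0 < t"
        using pos[OF z] coord by simp
      then show "z \<in> hyperbolic_ray x w ` {0<..<1}"
        using t by auto
    qed
  qed
  moreover have "{0..<1::real} = insert 0 {0<..<1}"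
    by auto
  ultimately have "orthogonal_arc x y = hyperbolic_ray x w ` {0..<1}"
    unfolding orthogonal_arc_def S_def[symmetric] by simp
  moreover have "y \<in> hyperbolic_ray x w ` {0..<1}"
    using y_ray \<zeta>(1) by auto
  ultimately show ?thesis
    using that w by blast
qed

section \<open>The Apollonian weak metric along the arc\<close>

lemma cmod_of_real_mult_diff_square:
  assumes "cmod w = 1" "cmod a = 1"
  shows "(cmod (of_real s * w - a))\<^sup>2 = 1 + s\<^sup>2 - 2 * s * (w \<bullet> a)"
  using assms dot_norm_neg[of "s *\<^sub>R w" a]
  by (simp add: power_mult_distrib scaleR_conv_of_real[symmetric])

text \<open>The bound is the value at \<open>a = w\<close>. After squaring and cross-multiplying,
  the two sides differ by \<open>2 * (t - s) * (1 - s * t) * (1 - d)\<close>, where \<open>d\<close>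
  is the cosine of the angle between \<open>w\<close> and \<open>a\<close>.\<close>

lemma radius_ratio_le:
  assumes w: "cmod w = 1" and a: "cmod a = 1" and "0 \<le> s" "s \<le> t" "t < 1"
  shows "cmod (of_real s * w - a) / cmod (of_real t * w - a) \<le> (1 - s) / (1 - t)"
proof -
  define d where "d = w \<bullet> a"
  have "d \<le> 1"
    using norm_cauchy_schwarz[of w a] w a by (simp add: d_def)
  have st: "s * t \<le> 1 * 1"
    using assms by (intro mult_mono) auto
  have "0 \<le> 2 * (t - s) * (1 - s * t) * (1 - d)"
    using assms st \<open>d \<le> 1\<close> by simp
  also have "\<dots> = (1 - s)\<^sup>2 * (1 + t\<^sup>2 - 2 * t * d) - (1 - t)\<^sup>2 * (1 + s\<^sup>2 - 2 * s * d)"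
    by (simp add: power2_eq_square algebra_simps)
  finally have "((1 - t) * cmod (of_real s * w - a))\<^sup>2 \<le> ((1 - s) * cmod (of_real t * w - a))\<^sup>2"
    unfolding power_mult_distrib cmod_of_real_mult_diff_square[OF w a] d_def by simp
  then have "(1 - t) * cmod (of_real s * w - a) \<le> (1 - s) * cmod (of_real t * w - a)"
    by (rule power2_le_imp_le) (use assms in simp)
  moreover have "of_real t * w \<noteq> a"
    using w a assms by (auto simp: norm_mult)
  ultimately show ?thesis
    using assms by (simp add: divide_simps mult.commute)
qed

text \<open>The supremum is attained at the endpoint of the ray, whatever \<open>s\<close> and
  \<open>t\<close> are. The metric is thus a difference of values of one function, which makes it
  additive along the ray.\<close>

lemma apollonian_hyperbolic_ray:
  assumes x: "cmod x < 1" and w: "cmod w = 1" and "0 \<le> s" "s \<le> t" "t < 1"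
  shows "apollonian (hyperbolic_ray x w s) (hyperbolic_ray x w t) =
    ln (cmod (hyperbolic_ray x w s - hyperbolic_ray x w 1)) -
    ln (cmod (hyperbolic_ray x w t - hyperbolic_ray x w 1))"
proof -
  let ?p = "hyperbolic_ray x w s" and ?q = "hyperbolic_ray x w t" and ?e = "hyperbolic_ray x w 1"
  have nx: "cmod (- x) < 1"
    using x by simp
  have norms: "cmod (of_real s * w) \<le> 1" "cmod (of_real t * w) \<le> 1"
    using assms by (simp_all add: norm_mult)
  have cs: "1 - cnj (- x) * (of_real s * w) \<noteq> 0" and ct: "1 - cnj (- x) * (of_real t * w) \<noteq> 0"
    using one_minus_cnj_mult_neq_0[OF nx] norms by blast+
  have xx: "1 - cnj (- x) * (- x) \<noteq> 0"
    using one_minus_cnj_mult_neq_0[OF nx, of "- x"] nx by simp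
  \<comment> \<open>This is what remains of the Moebius denominators in the quotient of distances;
    it does not depend on the boundary point.\<close>
  define m where "m = cmod (1 - cnj (- x) * (of_real t * w)) / cmod (1 - cnj (- x) * (of_real s * w))"
  have m: "0 < m"
    using cs ct by (simp add: m_def)
  have ratio: "cmod (?p - Moebius_function 0 (- x) \<alpha>) / cmod (?q - Moebius_function 0 (- x) \<alpha>) =
      cmod (of_real s * w - \<alpha>) / cmod (of_real t * w - \<alpha>) * m" if \<alpha>: "cmod \<alpha> = 1" for \<alpha>
  proof -
    have "1 - cnj (- x) * \<alpha> \<noteq> 0"
      using one_minus_cnj_mult_neq_0[OF nx, of \<alpha>] \<alpha> by simp
    then show ?thesis
      using cs ct xx \<alpha> norms
      unfolding hyperbolic_ray_def m_def
      by (simp only: Moebius_function_diff[OF nx] order_refl norm_divide norm_mult)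
         (simp add: divide_simps)
  qed
  have inside: "cmod ?p < 1" "cmod ?q < 1"
    using hyperbolic_ray_in_ball[OF x w] assms by simp_all
  have e: "cmod ?e = 1"
    using Moebius_function_norm_eq_1[OF nx, of w] w by (simp add: hyperbolic_ray_def)
  have "of_real s * w - w = of_real (s - 1) * w" "of_real t * w - w = of_real (t - 1) * w"
    by (simp_all add: algebra_simps)
  then have re: "cmod (?p - ?e) / cmod (?q - ?e) = (1 - s) / (1 - t) * m"
    using ratio[OF w] w assms unfolding hyperbolic_ray_def[of x w 1]
    by (simp add: norm_mult del: of_real_diff)
  have max: "ln (cmod (?p - a) / cmod (?q - a)) \<le> ln (cmod (?p - ?e) / cmod (?q - ?e))"
    if a: "cmod a = 1" for a
  proof -
    \<comment> \<open>Every boundary point is the image of a boundary point, so the bound for radii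
      applies to all of them.\<close>
    define \<alpha> where "\<alpha> = Moebius_function 0 x a"
    have \<alpha>: "cmod \<alpha> = 1" "Moebius_function 0 (- x) \<alpha> = a"
      using Moebius_function_norm_eq_1[OF x a] Moebius_function_inverse[OF x, of a] a
      by (simp_all add: \<alpha>_def)
    have "cmod (?p - a) / cmod (?q - a) \<le> cmod (?p - ?e) / cmod (?q - ?e)"
      unfolding re ratio[OF \<alpha>(1), unfolded \<alpha>(2)]
      using radius_ratio_le[OF w \<alpha>(1)] assms m by (intro mult_right_mono) auto
    moreover have "0 < cmod (?p - a) / cmod (?q - a)"
      using inside a by (intro divide_pos_pos) auto
    ultimately show ?thesis
      by simp
  qed
  have "apollonian ?p ?q = ln (cmod (?p - ?e) / cmod (?q - ?e))"
    unfolding apollonian_def by (rule cSup_eq_maximum) (use e max in auto)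
  also have "\<dots> = ln (cmod (?p - ?e)) - ln (cmod (?q - ?e))"
    using inside e by (intro ln_divide_pos) auto
  finally show ?thesis .
qed

text \<open>A geodesic is a path rather than a set, so the claim concerns every injective continuous
  parametrization of the arc starting at \<open>x\<close>; the first conjunct shows that such a
  parametrization exists.\<close>

theorem theorem3:
  fixes x y :: complex
  assumes "x \<in> ball 0 1" and "y \<in> ball 0 1" and "x \<noteq> y"
  shows "(\<exists>I \<gamma>. parametrizes_from x (orthogonal_arc x y) I \<gamma>) \<and>
    (\<forall>I \<gamma>. parametrizes_from x (orthogonal_arc x y) I \<gamma> \<longrightarrow>
       weak_geodesic apollonian (ball 0 1) I \<gamma> \<and>
       (\<exists>t0\<in>I. (\<forall>t\<in>I. t0 \<le> t) \<and> \<gamma> t0 = x) \<and> (\<exists>s\<in>I. \<gamma> s = y))"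
proof -
  have x: "cmod x < 1" and y: "cmod y < 1"
    using assms by simp_all
  obtain w where w: "cmod w = 1" and arc: "orthogonal_arc x y = hyperbolic_ray x w ` {0..<1}"
    and y_arc: "y \<in> orthogonal_arc x y"
    using orthogonal_arc_eq_hyperbolic_ray[OF x y assms(3)] by metis
  define \<phi> where "\<phi> = ray_coordinate x w"
  have coord: "\<phi> (hyperbolic_ray x w t) = t" if "t \<in> {0..<1}" for t
    using ray_coordinate_hyperbolic_ray[OF x w] that by (simp add: \<phi>_def)
  have arc_ball: "orthogonal_arc x y \<subseteq> ball 0 1"
    using hyperbolic_ray_in_ball[OF x w] by (auto simp: arc simp del: mem_ball)
  have ray_cont: "continuous_on {0..<1} (hyperbolic_ray x w)"
    by (rule continuous_on_subset[OF continuous_on_hyperbolic_ray[OF x w]]) auto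
  have "parametrizes_from x (orthogonal_arc x y) {0..<1} (hyperbolic_ray x w)"
    unfolding parametrizes_from_def arc
    using ray_cont coord
    by (auto simp: is_interval_1 intro!: inj_on_inverseI[where g = \<phi>] bexI[of _ 0])
  moreover have "weak_geodesic apollonian (ball 0 1) I \<gamma> \<and> (\<exists>s\<in>I. \<gamma> s = y)"
    if param: "parametrizes_from x (orthogonal_arc x y) I \<gamma>" for I \<gamma>
  proof -
    from param obtain t0 where I: "is_interval I" and cont: "continuous_on I \<gamma>" and inj: "inj_on \<gamma> I"
      and img: "\<gamma> ` I = orthogonal_arc x y" and t0: "t0 \<in> I" "\<And>t. t \<in> I \<Longrightarrow> t0 \<le> t" "\<gamma> t0 = x"
      unfolding parametrizes_from_def by blast
    obtain s where s: "s \<in> I" "\<gamma> s = y"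
      using y_arc img by (metis imageE)
    have ray: "\<gamma> t = hyperbolic_ray x w (\<phi> (\<gamma> t))" "\<phi> (\<gamma> t) \<in> {0..<1}" if t: "t \<in> I" for t
    proof -
      obtain r where "r \<in> {0..<1}" "\<gamma> t = hyperbolic_ray x w r"
        using imageI[OF t, of \<gamma>] unfolding img arc by blast
      then show "\<gamma> t = hyperbolic_ray x w (\<phi> (\<gamma> t))" "\<phi> (\<gamma> t) \<in> {0..<1}"
        using coord by simp_all
    qed
    have "continuous_on I (\<phi> \<circ> \<gamma>)"
      using cont img arc_ball continuous_on_ray_coordinate[OF x] unfolding \<phi>_def
      by (metis continuous_on_compose continuous_on_subset)
    moreover have "inj_on (\<phi> \<circ> \<gamma>) I"
    proof (rule inj_onI)
      fix t t' assume "t \<in> I" "t' \<in> I" "(\<phi> \<circ> \<gamma>) t = (\<phi> \<circ> \<gamma>) t'"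
      then have "\<gamma> t = \<gamma> t'"
        using ray(1)[of t] ray(1)[of t'] by simp
      then show "t = t'"
        using inj \<open>t \<in> I\<close> \<open>t' \<in> I\<close> by (simp add: inj_on_def)
    qed
    \<comment> \<open>A continuous injective real function on an interval is strictly monotone. It
      cannot decrease here, because it starts at 0, the least coordinate on the arc.\<close>
    ultimately have "strict_mono_on I (\<phi> \<circ> \<gamma>) \<or> strict_antimono_on I (\<phi> \<circ> \<gamma>)"
      using injective_eq_monotone_map[OF I] by blast
    moreover have "\<not> strict_antimono_on I (\<phi> \<circ> \<gamma>)"
    proof
      assume "strict_antimono_on I (\<phi> \<circ> \<gamma>)"
      moreover have "t0 < s"
        using t0(2)[OF s(1)] t0(3) s(2) assms(3) by (cases "t0 = s") auto
      ultimately have "\<phi> (\<gamma> s) < \<phi> (\<gamma> t0)"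
        using t0(1) s(1) by (auto simp: monotone_on_def)
      moreover have "\<phi> (\<gamma> t0) = 0"
        using coord[of 0] t0(3) by simp
      ultimately show False
        using ray(2)[OF s(1)] by simp
    qed
    ultimately have mono: "\<phi> (\<gamma> t) \<le> \<phi> (\<gamma> t')" if "t \<in> I" "t' \<in> I" "t \<le> t'" for t t'
      using that by (cases "t = t'") (auto simp: monotone_on_def less_imp_le)
    have "apollonian (\<gamma> t) (\<gamma> t') =
        ln (cmod (\<gamma> t - hyperbolic_ray x w 1)) - ln (cmod (\<gamma> t' - hyperbolic_ray x w 1))"
      if "t \<in> I" "t' \<in> I" "t \<le> t'" for t t'
      using apollonian_hyperbolic_ray[OF x w, of "\<phi> (\<gamma> t)" "\<phi> (\<gamma> t')"]
        ray(2)[OF that(1)] ray(2)[OF that(2)] mono[OF that]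
      unfolding ray(1)[OF that(1), symmetric] ray(1)[OF that(2), symmetric] by simp
    \<comment> \<open>The three distances are differences of the same function, so the sum
      telescopes.\<close>
    then have "aligned apollonian (\<gamma> t1) (\<gamma> t2) (\<gamma> t3)"
      if "t1 \<in> I" "t2 \<in> I" "t3 \<in> I" "t1 \<le> t2" "t2 \<le> t3" for t1 t2 t3
      using that by (simp add: aligned_def)
    then have "weak_geodesic apollonian (ball 0 1) I \<gamma>"
      unfolding weak_geodesic_def using I cont img arc_ball by blast
    then show ?thesis
      using s by blast
  qed
  ultimately show ?thesis
    unfolding parametrizes_from_def by blast
qed

end
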